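(* Suppose that a Markov chain $X_t$ (on a finite state space, with stationary distribution $\mu$) has a lifting $(X_t,Y_t)$ (also on a finite state space), and that the complex-valued function $\Psi$, not identically zero, is an eigenfunction of the lifted Markov chain with eigenvalue $\lambda\in\mathbb{C}$: $$\mathbb{E}[\Psi(X_{t+1},Y_{t+1})\mid (X_t,Y_t)]=\lambda\,\Psi(X_t,Y_t).$$ Suppose that $|\Psi(x,y)|$ is a function of $x$ alone, that $|\lambda|<1$ and $\Re(\lambda)\ge 1/2$, and that $R$ is an upper bound on $\mathbb{E}\big[|\Psi(X_{t+1},Y_{t+1})-\Psi(X_t,Y_t)|^2\mid (X_t,Y_t)\big]$ valid for every value of $(X_t,Y_t)$. Let $\gamma=1-\Re(\lambda)$ and $\Psi_{\max}=\max_{x,y}|\Psi(x,y)|$, and let $\varepsilon>0$. Then whenever the number of Markov chain steps $t$ (a nonnegative integer) satisfies $$t\le \frac{\log \Psi_{\max}+\frac12\log\frac{\gamma\varepsilon}{4R}}{-\log(1-\gamma)},$$ the variation distance of $X_t$ (the state of the original Markov chain) from stationarity is at least $1-\varepsilon$, i.e. $\max_x\|P^{*t}_x-\mu\|_{\mathrm{TV}}\ge 1-\varepsilon$.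
   Context: A lifting of a Markov chain $X_t$ is a Markov chain $(X_t,Y_t)$ on a larger state space of pairs $(x,y)$ whose first coordinate evolves as the original chain: from any state $(x,y)$, the conditional law of the next first coordinate is the transition law of the original chain from $x$. $P^{*t}_x$ denotes the distribution of the original chain after $t$ steps when started at $x$. The total variation distance between probability distributions $\nu,\mu$ on a finite set is $\|\nu-\mu\|_{\mathrm{TV}}=\max_A|\nu(A)-\mu(A)|=\frac12\sum_y|\nu(y)-\mu(y)|$. *)

theory Defs
  imports "HOL-Probability.Probability"
begin

text \<open>A finite Markov chain is a transition kernel \<open>K\<close> on a finite carrier \<open>S\<close>; the values of \<open>K\<close>
  outside \<open>S\<close> are irrelevant.\<close>

definition finite_markov_chain :: "'a set \<Rightarrow> ('a \<Rightarrow> 'a pmf) \<Rightarrow> bool" where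
  "finite_markov_chain S K \<longleftrightarrow> finite S \<and> (\<forall>x\<in>S. set_pmf (K x) \<subseteq> S)"

primrec step_distr :: "('a \<Rightarrow> 'a pmf) \<Rightarrow> nat \<Rightarrow> 'a \<Rightarrow> 'a pmf" where
  "step_distr K 0 x = return_pmf x"
| "step_distr K (Suc t) x = bind_pmf (step_distr K t x) K"

definition stationary_distr :: "'a set \<Rightarrow> ('a \<Rightarrow> 'a pmf) \<Rightarrow> 'a pmf \<Rightarrow> bool" where
  "stationary_distr S K \<mu> \<longleftrightarrow> set_pmf \<mu> \<subseteq> S \<and> bind_pmf \<mu> K = \<mu>"

text \<open>The state space \<open>\<Omega>\<close> of a lifting may be any finite set of pairs over \<open>S\<close>, not only a full
  product. It is not required that every \<open>x \<in> S\<close> occurs as a first coordinate, so liftings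
  that do project onto \<open>S\<close> are a special case.\<close>

definition lifting_of ::
  "'a set \<Rightarrow> ('a \<Rightarrow> 'a pmf) \<Rightarrow> ('a \<times> 'b) set \<Rightarrow> ('a \<times> 'b \<Rightarrow> ('a \<times> 'b) pmf) \<Rightarrow> bool" where
  "lifting_of S K \<Omega> L \<longleftrightarrow>
     finite_markov_chain \<Omega> L \<and> fst ` \<Omega> \<subseteq> S \<and>
     (\<forall>(x, y)\<in>\<Omega>. map_pmf fst (L (x, y)) = K x)"

definition eigenfunction :: "'a set \<Rightarrow> ('a \<Rightarrow> 'a pmf) \<Rightarrow> ('a \<Rightarrow> complex) \<Rightarrow> complex \<Rightarrow> bool" where
  "eigenfunction S K f c \<longleftrightarrow>
     (\<exists>x\<in>S. f x \<noteq> 0) \<and> (\<forall>x\<in>S. measure_pmf.expectation (K x) f = c * f x)"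

definition tv_dist :: "'a set \<Rightarrow> 'a pmf \<Rightarrow> 'a pmf \<Rightarrow> real" where
  "tv_dist S \<nu> \<mu> = Max ((\<lambda>A. \<bar>measure_pmf.prob \<nu> A - measure_pmf.prob \<mu> A\<bar>) ` Pow S)"

end

theory Submission
  imports Defs
begin

text \<open>
  The squared modulus of an eigenfunction \<open>f\<close> with eigenvalue \<open>c\<close> obeys an exact one-step law: expanding
  the square and using the eigenvalue equation for the cross term,
  \<open>E |f(X')|\<^sup>2 = (2 Re c - 1) |f(X)|\<^sup>2 + E |f(X') - f(X)|\<^sup>2\<close>. With \<open>\<gamma> = 1 - Re c\<close> the
  factor is \<open>1 - 2 \<gamma>\<close>, and the last term is at most \<open>R\<close>. The map \<open>u \<mapsto> (1 - 2 \<gamma>) u + R\<close> has the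
  fixed point \<open>R / (2 \<gamma>)\<close>, and this number bounds two quantities.

  Started at a state where \<open>|\<Psi>|\<close> is maximal, the lifted chain has mean \<open>E \<Psi> = ev ^ t * \<Psi> \<omega>\<close>,
  of modulus at least \<open>(1 - \<gamma>) ^ t * \<Psi>max\<close>, while the variance of \<open>\<Psi>\<close> is at most
  \<open>R / (2 \<gamma>)\<close> at all times (\<open>second_moment_le\<close>). The bound on \<open>t\<close> is what makes the modulus \<open>a\<close>
  of the mean satisfy \<open>a\<^sup>2 \<ge> 4 R / (\<gamma> \<epsilon>)\<close>, so Chebyshev's inequality gives \<open>|\<Psi>| \<ge> a / 2\<close> except
  with probability \<open>\<epsilon> / 2\<close>.

  In stationarity the second moment of \<open>|\<Psi>|\<close> reproduces itself in one step, so it is at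
  most \<open>R / (2 \<gamma>)\<close> as well (\<open>stationary_drift_le\<close>), and Markov's inequality gives \<open>|\<Psi>| \<ge> a / 2\<close> with probability
  at most \<open>\<epsilon> / 2\<close>. Since \<open>|\<Psi>|\<close> depends on the first coordinate only, this event concerns the
  original chain, and it separates the two laws by \<open>1 - \<epsilon>\<close>.

  Only the original chain is given a stationary law \<open>\<mu>\<close>, and \<open>\<mu>\<close> may charge states with no
  lift. The set of states that have a lift is closed under the dynamics, and a stationary law
  carries no flow into a closed set from outside; so \<open>|\<Psi>|\<close> can be extended by zero, and one step of the lifted
  kernel from an arbitrary lift of each state suffices.
\<close>

section \<open>Expectations over finitely supported distributions\<close>

lemma expectation_mono_finite:
  fixes f g :: "'a \<Rightarrow> real"
  assumes "finite (set_pmf p)" "\<And>x. x \<in> set_pmf p \<Longrightarrow> f x \<le> g x"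
  shows "measure_pmf.expectation p f \<le> measure_pmf.expectation p g"
  using assms by (intro integral_mono_AE) (auto simp: AE_measure_pmf_iff integrable_measure_pmf_finite)

lemma expectation_cong:
  fixes f g :: "'a \<Rightarrow> 'b::{banach,second_countable_topology}"
  assumes "\<And>x. x \<in> set_pmf p \<Longrightarrow> f x = g x"
  shows "measure_pmf.expectation p f = measure_pmf.expectation p g"
  using assms by (intro integral_cong_AE) (auto simp: AE_measure_pmf_iff)

lemma expectation_bind_finite:
  fixes h :: "'b \<Rightarrow> 'c::{banach,second_countable_topology}"
  assumes "finite (set_pmf p)" "\<And>x. x \<in> set_pmf p \<Longrightarrow> finite (set_pmf (f x))"
  shows "measure_pmf.expectation (bind_pmf p f) h
    = measure_pmf.expectation p (\<lambda>x. measure_pmf.expectation (f x) h)"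
  using assms by (simp add: pmf_expectation_bind[where A = "set_pmf p"]
      integral_measure_pmf[where A = "set_pmf p"])

lemma prob_ge_le_expectation_divide:
  fixes u :: "'a \<Rightarrow> real"
  assumes "finite (set_pmf p)" "\<And>x. 0 \<le> u x" "0 < c"
  shows "measure_pmf.prob p {x. u x \<ge> c} \<le> measure_pmf.expectation p u / c"
  using integral_Markov_inequality_measure[of "measure_pmf p" u "{}" c] assms
  by (simp add: integrable_measure_pmf_finite)

lemma expectation_dist_mean_square:
  fixes f :: "'a \<Rightarrow> complex"
  assumes "finite (set_pmf p)" and m: "m = measure_pmf.expectation p f"
  shows "measure_pmf.expectation p (\<lambda>x. (cmod (f x - m))\<^sup>2)
    = measure_pmf.expectation p (\<lambda>x. (cmod (f x))\<^sup>2) - (cmod m)\<^sup>2"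
proof -
  have int: "integrable (measure_pmf p) h" for h :: "'a \<Rightarrow> 'c::{banach,second_countable_topology}"
    using assms(1) by (rule integrable_measure_pmf_finite)
  have "(cmod (f x - m))\<^sup>2 = (cmod (f x))\<^sup>2 - 2 * Re (cnj m * f x) + (cmod m)\<^sup>2" for x
    unfolding cmod_power2 by (simp add: power2_eq_square algebra_simps)
  then have "measure_pmf.expectation p (\<lambda>x. (cmod (f x - m))\<^sup>2)
    = measure_pmf.expectation p (\<lambda>x. (cmod (f x))\<^sup>2)
      - 2 * measure_pmf.expectation p (\<lambda>x. Re (cnj m * f x)) + (cmod m)\<^sup>2"
    by (simp add: int)
  also have "measure_pmf.expectation p (\<lambda>x. Re (cnj m * f x)) = Re (cnj m * m)"
    by (simp add: int m del: times_complex.sel)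
  also have "Re (cnj m * m) = (cmod m)\<^sup>2"
    unfolding cmod_power2 by (simp add: power2_eq_square)
  finally show ?thesis by simp
qed

text \<open>Chebyshev's inequality about the mean \<open>m\<close>: where \<open>|f|\<close> is below half of \<open>|m|\<close>, the
  distance from \<open>f\<close> to \<open>m\<close> exceeds half of \<open>|m|\<close>.\<close>

lemma prob_cmod_less_half_mean:
  fixes f :: "'a \<Rightarrow> complex"
  assumes fin: "finite (set_pmf p)" and m: "m = measure_pmf.expectation p f" "m \<noteq> 0"
    and v: "measure_pmf.expectation p (\<lambda>x. (cmod (f x))\<^sup>2) \<le> (cmod m)\<^sup>2 + v"
  shows "measure_pmf.prob p {x. cmod (f x) < cmod m / 2} \<le> 4 * v / (cmod m)\<^sup>2"
proof -
  have "measure_pmf.prob p {x. cmod (f x) < cmod m / 2}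
      \<le> measure_pmf.prob p {x. (cmod m / 2)\<^sup>2 \<le> (cmod (f x - m))\<^sup>2}"
  proof (rule measure_pmf.finite_measure_mono)
    show "{x. cmod (f x) < cmod m / 2} \<subseteq> {x. (cmod m / 2)\<^sup>2 \<le> (cmod (f x - m))\<^sup>2}"
    proof clarify
      fix x assume "cmod (f x) < cmod m / 2"
      then have "cmod m / 2 \<le> cmod (f x - m)"
        using norm_triangle_ineq2[of m "f x"] by (simp add: norm_minus_commute)
      then show "(cmod m / 2)\<^sup>2 \<le> (cmod (f x - m))\<^sup>2"
        by (rule power_mono) simp
    qed
  qed simp
  also have "\<dots> \<le> measure_pmf.expectation p (\<lambda>x. (cmod (f x - m))\<^sup>2) / (cmod m / 2)\<^sup>2"
    using m(2) by (intro prob_ge_le_expectation_divide[OF fin]) auto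
  also have "\<dots> \<le> v / (cmod m / 2)\<^sup>2"
    using v expectation_dist_mean_square[OF fin m(1)] by (intro divide_right_mono) auto
  finally show ?thesis by (simp add: power_divide mult.commute)
qed

section \<open>Finite Markov chains and their liftings\<close>

lemma set_step_distr:
  assumes "finite_markov_chain S K" "x \<in> S"
  shows "set_pmf (step_distr K t x) \<subseteq> S"
  using assms by (induction t) (auto simp: finite_markov_chain_def)

lemma finite_set_step_distr:
  assumes "finite_markov_chain S K" "x \<in> S"
  shows "finite (set_pmf (step_distr K t x))"
  using set_step_distr[OF assms, of t] assms(1) finite_subset
  unfolding finite_markov_chain_def by blast

lemma finite_set_kernel:
  assumes "finite_markov_chain S K" "x \<in> S"
  shows "finite (set_pmf (K x))"
  using assms finite_subset unfolding finite_markov_chain_def by blast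

lemma expectation_step_distr_Suc:
  fixes h :: "'a \<Rightarrow> 'c::{banach,second_countable_topology}"
  assumes "finite_markov_chain S K" "x \<in> S"
  shows "measure_pmf.expectation (step_distr K (Suc t) x) h
    = measure_pmf.expectation (step_distr K t x) (\<lambda>y. measure_pmf.expectation (K y) h)"
proof -
  have "finite (set_pmf (K y))" if "y \<in> set_pmf (step_distr K t x)" for y
    using that set_step_distr[OF assms, of t] finite_set_kernel[OF assms(1)] by blast
  then show ?thesis
    using finite_set_step_distr[OF assms] by (simp add: expectation_bind_finite)
qed

lemma map_step_distr_lifting:
  assumes lift: "lifting_of S K \<Omega> L" and \<omega>: "\<omega> \<in> \<Omega>"
  shows "map_pmf fst (step_distr L t \<omega>) = step_distr K t (fst \<omega>)"
proof (induction t)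
  case (Suc t)
  have "map_pmf fst (L \<omega>') = K (fst \<omega>')" if "\<omega>' \<in> set_pmf (step_distr L t \<omega>)" for \<omega>'
    using that lift set_step_distr[of \<Omega> L \<omega> t] \<omega> unfolding lifting_of_def by fastforce
  then have "map_pmf fst (step_distr L (Suc t) \<omega>) = bind_pmf (step_distr L t \<omega>) (\<lambda>\<omega>'. K (fst \<omega>'))"
    by (simp add: map_bind_pmf cong: bind_pmf_cong)
  also have "\<dots> = bind_pmf (map_pmf fst (step_distr L t \<omega>)) K"
    by (simp add: bind_map_pmf)
  finally show ?case by (simp add: Suc)
qed simp

section \<open>Mean and second moment of an eigenfunction\<close>

lemma expectation_eigenfunction_step_distr:
  assumes "finite_markov_chain S K" "eigenfunction S K f c" "x \<in> S"
  shows "measure_pmf.expectation (step_distr K t x) f = c ^ t * f x"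
proof (induction t)
  case (Suc t)
  have "measure_pmf.expectation (step_distr K (Suc t) x) f
      = measure_pmf.expectation (step_distr K t x) (\<lambda>y. c * f y)"
    unfolding expectation_step_distr_Suc[OF assms(1,3)]
    using set_step_distr[OF assms(1,3), of t] assms(2)
    by (intro expectation_cong) (auto simp: eigenfunction_def)
  then show ?case using Suc by simp
qed simp

text \<open>The cross term in the expansion of \<open>|f y - f x|\<^sup>2\<close> is linear in \<open>f y\<close>, so its mean is governed
  by the eigenvalue equation.\<close>

lemma expectation_eigenfunction_square:
  assumes "finite_markov_chain S K" "eigenfunction S K f c" "x \<in> S"
  shows "measure_pmf.expectation (K x) (\<lambda>y. (cmod (f y))\<^sup>2)
    = (2 * Re c - 1) * (cmod (f x))\<^sup>2
      + measure_pmf.expectation (K x) (\<lambda>y. (cmod (f y - f x))\<^sup>2)"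
proof -
  have int: "integrable (measure_pmf (K x)) h" for h :: "'a \<Rightarrow> 'c::{banach,second_countable_topology}"
    using finite_set_kernel[OF assms(1,3)] by (rule integrable_measure_pmf_finite)
  have ev: "measure_pmf.expectation (K x) f = c * f x"
    using assms by (auto simp: eigenfunction_def)
  have "measure_pmf.expectation (K x) (\<lambda>y. (cmod (f y))\<^sup>2)
    = measure_pmf.expectation (K x)
        (\<lambda>y. (cmod (f y - f x))\<^sup>2 + 2 * Re (cnj (f x) * f y) - (cmod (f x))\<^sup>2)"
    unfolding cmod_power2 by (simp add: power2_eq_square algebra_simps)
  also have "\<dots> = measure_pmf.expectation (K x) (\<lambda>y. (cmod (f y - f x))\<^sup>2)
      + 2 * measure_pmf.expectation (K x) (\<lambda>y. Re (cnj (f x) * f y)) - (cmod (f x))\<^sup>2"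
    by (simp add: int)
  also have "measure_pmf.expectation (K x) (\<lambda>y. Re (cnj (f x) * f y)) = Re (cnj (f x) * (c * f x))"
    by (simp add: int ev del: times_complex.sel)
  also have "\<dots> = Re c * (cmod (f x))\<^sup>2"
    unfolding cmod_power2 by (simp add: power2_eq_square algebra_simps)
  finally show ?thesis by (simp add: algebra_simps)
qed

text \<open>This bounds the variance of \<open>f\<close> after \<open>t\<close> steps by \<open>R / (2 (1 - Re c))\<close>, uniformly in \<open>t\<close>. The
  induction closes because the second moment contracts at least as fast as the squared mean:
  \<open>2 Re c - 1 \<le> |c|\<^sup>2\<close>, which is \<open>0 \<le> |1 - c|\<^sup>2\<close>. The
  hypothesis \<open>1 / 2 \<le> Re c\<close> makes the contraction factor nonnegative, so that the induction hypothesis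
  may be multiplied by it.\<close>

lemma second_moment_le:
  assumes K: "finite_markov_chain S K" and f: "eigenfunction S K f c" and x: "x \<in> S"
    and c: "1 / 2 \<le> Re c" "Re c < 1"
    and R: "\<And>y. y \<in> S \<Longrightarrow> measure_pmf.expectation (K y) (\<lambda>z. (cmod (f z - f y))\<^sup>2) \<le> R"
  shows "measure_pmf.expectation (step_distr K t x) (\<lambda>y. (cmod (f y))\<^sup>2)
    \<le> (cmod (c ^ t * f x))\<^sup>2 + R / (2 * (1 - Re c))"
proof (induction t)
  case 0
  have "0 \<le> measure_pmf.expectation (K x) (\<lambda>z. (cmod (f z - f x))\<^sup>2)"
    by (rule Bochner_Integration.integral_nonneg) simp
  with R[OF x] have "0 \<le> R" by linarith
  then show ?case using c by simp
next
  case (Suc t)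
  let ?p = "step_distr K t x" and ?a = "2 * Re c - 1" and ?m = "cmod (c ^ t * f x)"
  have "(Re c)\<^sup>2 \<ge> ?a"
    using zero_le_power2[of "Re c - 1"] by (simp add: power2_eq_square algebra_simps)
  then have a_le: "?a \<le> (cmod c)\<^sup>2"
    unfolding cmod_power2 using zero_le_power2[of "Im c"] by linarith
  have "measure_pmf.expectation (step_distr K (Suc t) x) (\<lambda>y. (cmod (f y))\<^sup>2)
      = measure_pmf.expectation ?p
          (\<lambda>y. measure_pmf.expectation (K y) (\<lambda>z. (cmod (f z))\<^sup>2))"
    by (rule expectation_step_distr_Suc[OF K x])
  also have "\<dots> \<le> measure_pmf.expectation ?p (\<lambda>y. ?a * (cmod (f y))\<^sup>2 + R)"
  proof (rule expectation_mono_finite)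
    show "finite (set_pmf ?p)" by (rule finite_set_step_distr[OF K x])
    fix y assume "y \<in> set_pmf ?p"
    then have "y \<in> S" using set_step_distr[OF K x] by blast
    then show "measure_pmf.expectation (K y) (\<lambda>z. (cmod (f z))\<^sup>2) \<le> ?a * (cmod (f y))\<^sup>2 + R"
      using expectation_eigenfunction_square[OF K f] R by simp
  qed
  also have "\<dots> = ?a * measure_pmf.expectation ?p (\<lambda>y. (cmod (f y))\<^sup>2) + R"
    by (simp add: integrable_measure_pmf_finite[OF finite_set_step_distr[OF K x]])
  also have "\<dots> \<le> ?a * (?m\<^sup>2 + R / (2 * (1 - Re c))) + R"
    using Suc c by (intro add_right_mono mult_left_mono) auto
  also have "\<dots> = ?a * ?m\<^sup>2 + R / (2 * (1 - Re c))"
    using c by (simp add: field_simps)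
  also have "?a * ?m\<^sup>2 \<le> (cmod c)\<^sup>2 * ?m\<^sup>2"
    using a_le by (rule mult_right_mono) simp
  finally show ?case by (simp add: norm_mult power_mult_distrib mult.assoc)
qed

text \<open>If no step could change the value of \<open>f\<close>, its eigenvalue would be 1. Positivity of \<open>R\<close> gives the
  quotient and the logarithm in the bound on \<open>t\<close> their usual meaning.\<close>

lemma eigenfunction_increment_bound_pos:
  assumes K: "finite_markov_chain S K" and f: "eigenfunction S K f c" and c: "c \<noteq> 1"
    and R: "\<And>y. y \<in> S \<Longrightarrow> measure_pmf.expectation (K y) (\<lambda>z. (cmod (f z - f y))\<^sup>2) \<le> R"
  shows "0 < R"
proof (rule ccontr)
  assume "\<not> 0 < R"
  obtain x where x: "x \<in> S" "f x \<noteq> 0" using f by (auto simp: eigenfunction_def)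
  have int: "integrable (measure_pmf (K x)) (\<lambda>z. (cmod (f z - f x))\<^sup>2)"
    using finite_set_kernel[OF K x(1)] by (rule integrable_measure_pmf_finite)
  have "measure_pmf.expectation (K x) (\<lambda>z. (cmod (f z - f x))\<^sup>2) \<ge> 0"
    by (rule Bochner_Integration.integral_nonneg) simp
  then have "measure_pmf.expectation (K x) (\<lambda>z. (cmod (f z - f x))\<^sup>2) = 0"
    using R[OF x(1)] \<open>\<not> 0 < R\<close> by linarith
  then have "\<forall>z\<in>set_pmf (K x). f z = f x"
    using integral_nonneg_eq_0_iff_AE[OF int] by (simp add: AE_measure_pmf_iff)
  then have "measure_pmf.expectation (K x) f = measure_pmf.expectation (K x) (\<lambda>_. f x)"
    by (intro expectation_cong) auto
  then have "c * f x = f x" using f x(1) by (simp add: eigenfunction_def)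
  then show False using c x(2) by simp
qed

section \<open>Drift bounds in stationarity\<close>

text \<open>One step cannot decrease the mass of a closed set, and a state of positive mass outside that
  leads into the set would make it strictly increase.\<close>

lemma stationary_no_flow_into_closed:
  assumes "finite (set_pmf \<mu>)" and stat: "bind_pmf \<mu> K = \<mu>"
    and fin: "\<And>x. x \<in> set_pmf \<mu> \<Longrightarrow> finite (set_pmf (K x))"
    and closed: "\<And>x. x \<in> C \<Longrightarrow> set_pmf (K x) \<subseteq> C"
    and x: "x \<in> set_pmf \<mu>" "x \<notin> C"
  shows "set_pmf (K x) \<inter> C = {}"
proof -
  let ?d = "\<lambda>x. measure_pmf.prob (K x) C - indicator C x"
  have int: "integrable (measure_pmf \<mu>) h" for h :: "'a \<Rightarrow> real"
    using assms(1) by (rule integrable_measure_pmf_finite)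
  have "measure_pmf.prob \<mu> C = measure_pmf.expectation (bind_pmf \<mu> K) (indicator C)"
    by (simp add: stat)
  also have "\<dots> = measure_pmf.expectation \<mu> (\<lambda>x. measure_pmf.prob (K x) C)"
    using assms(1) fin by (subst expectation_bind_finite) auto
  finally have "measure_pmf.expectation \<mu> ?d = 0"
    by (simp add: int)
  moreover have "0 \<le> ?d x" for x
  proof (cases "x \<in> C")
    case True
    then have "measure_pmf.prob (K x) C = 1"
      using closed by (subst measure_pmf.prob_eq_1) (auto simp: AE_measure_pmf_iff)
    with True show ?thesis by simp
  qed simp
  ultimately have "AE x in measure_pmf \<mu>. ?d x = 0"
    using integral_nonneg_eq_0_iff_AE[OF int, of ?d] by simp
  with x have "measure_pmf.prob (K x) C = 0"
    by (auto simp: AE_measure_pmf_iff)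
  then show ?thesis by (simp add: measure_pmf_zero_iff)
qed

text \<open>Stationarity turns the drift bound into \<open>E h \<le> a * E h + R\<close>; the function \<open>h\<close> satisfies
  the drift bound a priori only on \<open>C\<close>; at states of positive mass off \<open>C\<close> both \<open>h\<close> and its mean after
  one step vanish.\<close>

lemma stationary_drift_le:
  fixes h :: "'a \<Rightarrow> real"
  assumes fin: "finite (set_pmf \<mu>)" and stat: "bind_pmf \<mu> K = \<mu>"
    and finK: "\<And>x. x \<in> set_pmf \<mu> \<Longrightarrow> finite (set_pmf (K x))"
    and closed: "\<And>x. x \<in> C \<Longrightarrow> set_pmf (K x) \<subseteq> C"
    and zero: "\<And>x. x \<notin> C \<Longrightarrow> h x = 0"
    and drift: "\<And>x. x \<in> C \<Longrightarrow> measure_pmf.expectation (K x) h \<le> a * h x + R"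
    and "a < 1" "0 \<le> R"
  shows "measure_pmf.expectation \<mu> h \<le> R / (1 - a)"
proof -
  have "measure_pmf.expectation \<mu> h = measure_pmf.expectation (bind_pmf \<mu> K) h"
    by (simp add: stat)
  also have "\<dots> = measure_pmf.expectation \<mu> (\<lambda>x. measure_pmf.expectation (K x) h)"
    using fin finK by (rule expectation_bind_finite)
  also have "\<dots> \<le> measure_pmf.expectation \<mu> (\<lambda>x. a * h x + R)"
  proof (rule expectation_mono_finite[OF fin])
    fix x assume x: "x \<in> set_pmf \<mu>"
    show "measure_pmf.expectation (K x) h \<le> a * h x + R"
    proof (cases "x \<in> C")
      case False
      have "set_pmf (K x) \<inter> C = {}"
        using stationary_no_flow_into_closed[OF fin stat finK closed x False] .
      then have "measure_pmf.expectation (K x) h = measure_pmf.expectation (K x) (\<lambda>_. 0)"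
        using zero by (intro expectation_cong) auto
      then show ?thesis using False zero \<open>0 \<le> R\<close> by simp
    qed (rule drift)
  qed
  also have "\<dots> = a * measure_pmf.expectation \<mu> h + R"
    by (simp add: integrable_measure_pmf_finite[OF fin])
  finally show ?thesis using \<open>a < 1\<close> by (simp add: field_simps)
qed

section \<open>Lower bound on the variation distance\<close>

lemma tv_dist_ge:
  assumes "finite S" "A \<subseteq> S"
  shows "measure_pmf.prob \<nu> A - measure_pmf.prob \<mu> A \<le> tv_dist S \<nu> \<mu>"
proof -
  have "\<bar>measure_pmf.prob \<nu> A - measure_pmf.prob \<mu> A\<bar> \<le> tv_dist S \<nu> \<mu>"
    unfolding tv_dist_def using assms by (intro Max_ge) auto
  then show ?thesis by linarith
qed

text \<open>The bound on \<open>t\<close> in the form used by Chebyshev's inequality: \<open>(1 - \<gamma>) ^ t * M\<close> is the lower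
  bound for the modulus of the mean.\<close>

lemma mean_square_ge_of_time_bound:
  fixes \<gamma> \<epsilon> R M :: real
  assumes "0 < \<gamma>" "\<gamma> < 1" "0 < \<epsilon>" "0 < R" "0 < M"
    and t: "real t \<le> (ln M + 1 / 2 * ln (\<gamma> * \<epsilon> / (4 * R))) / (- ln (1 - \<gamma>))"
  shows "4 * R / (\<gamma> * \<epsilon>) \<le> ((1 - \<gamma>) ^ t * M)\<^sup>2"
proof -
  have "ln (1 - \<gamma>) < 0" using assms by simp
  then have "real t * (- ln (1 - \<gamma>)) \<le> ln M + 1 / 2 * ln (\<gamma> * \<epsilon> / (4 * R))"
    using t by (subst (asm) pos_le_divide_eq) auto
  moreover have "ln (4 * R / (\<gamma> * \<epsilon>)) = - ln (\<gamma> * \<epsilon> / (4 * R))"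
    using assms by (subst ln_inverse[symmetric]) (auto simp: field_simps)
  moreover have "ln (((1 - \<gamma>) ^ t * M)\<^sup>2) = 2 * (real t * ln (1 - \<gamma>) + ln M)"
    using assms by (simp add: ln_mult ln_realpow)
  ultimately have "ln (4 * R / (\<gamma> * \<epsilon>)) \<le> ln (((1 - \<gamma>) ^ t * M)\<^sup>2)" by simp
  then show ?thesis
    by (subst (asm) ln_le_cancel_iff) (use assms in auto)
qed

theorem lemma2:
  fixes S :: "'a set" and K :: "'a \<Rightarrow> 'a pmf" and \<mu> :: "'a pmf"
    and \<Omega> :: "('a \<times> 'b) set" and L :: "'a \<times> 'b \<Rightarrow> ('a \<times> 'b) pmf"
    and \<Psi> :: "'a \<times> 'b \<Rightarrow> complex" and ev :: complex
    and R \<gamma> \<Psi>max \<epsilon> :: real and t :: nat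
  assumes "finite_markov_chain S K"
    and "stationary_distr S K \<mu>"
    and "lifting_of S K \<Omega> L"
    and "eigenfunction \<Omega> L \<Psi> ev"
    and "\<exists>g :: 'a \<Rightarrow> real. \<forall>(x, y)\<in>\<Omega>. cmod (\<Psi> (x, y)) = g x"
    and "cmod ev < 1"
    and "Re ev \<ge> 1 / 2"
    and "\<forall>\<omega>\<in>\<Omega>. measure_pmf.expectation (L \<omega>) (\<lambda>\<omega>'. (cmod (\<Psi> \<omega>' - \<Psi> \<omega>))\<^sup>2) \<le> R"
    and "\<gamma> = 1 - Re ev"
    and "\<Psi>max = Max ((\<lambda>\<omega>. cmod (\<Psi> \<omega>)) ` \<Omega>)"
    and "\<epsilon> > 0"
    and "real t \<le> (ln \<Psi>max + 1 / 2 * ln (\<gamma> * \<epsilon> / (4 * R))) / (- ln (1 - \<gamma>))"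
  shows "Max ((\<lambda>x. tv_dist S (step_distr K t x) \<mu>) ` S) \<ge> 1 - \<epsilon>"
proof -
  note K = assms(1) and lift = assms(3) and eig = assms(4)
  have L: "finite_markov_chain \<Omega> L" and fst\<Omega>: "fst ` \<Omega> \<subseteq> S"
    using lift by (auto simp: lifting_of_def)
  have proj: "map_pmf fst (L \<omega>) = K (fst \<omega>)" if "\<omega> \<in> \<Omega>" for \<omega>
    using lift that by (auto simp: lifting_of_def)
  have fin: "finite S" "finite \<Omega>" using K L by (auto simp: finite_markov_chain_def)
  have \<mu>: "set_pmf \<mu> \<subseteq> S" "bind_pmf \<mu> K = \<mu>"
    using assms(2) by (auto simp: stationary_distr_def)
  obtain g where g: "\<And>\<omega>. \<omega> \<in> \<Omega> \<Longrightarrow> cmod (\<Psi> \<omega>) = g (fst \<omega>)"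
    using assms(5) by fastforce
  have \<gamma>: "0 < \<gamma>" "\<gamma> \<le> 1 / 2" "Re ev = 1 - \<gamma>"
    using complex_Re_le_cmod[of ev] assms(6,7,9) by linarith+
  then have "ev \<noteq> 1" by auto
  have incr: "measure_pmf.expectation (L \<omega>) (\<lambda>\<omega>'. (cmod (\<Psi> \<omega>' - \<Psi> \<omega>))\<^sup>2) \<le> R" if "\<omega> \<in> \<Omega>" for \<omega>
    using assms(8) that by blast
  have R: "0 < R"
    using eigenfunction_increment_bound_pos[OF L eig \<open>ev \<noteq> 1\<close> incr] .
  obtain \<omega>1 where \<omega>1: "\<omega>1 \<in> \<Omega>" "\<Psi> \<omega>1 \<noteq> 0" using eig by (auto simp: eigenfunction_def)
  have "\<Psi>max \<in> (\<lambda>\<omega>. cmod (\<Psi> \<omega>)) ` \<Omega>"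
    unfolding assms(10) using fin(2) \<omega>1(1) by (intro Max_in) auto
  then obtain \<omega>0 where \<omega>0: "\<omega>0 \<in> \<Omega>" "cmod (\<Psi> \<omega>0) = \<Psi>max" by auto
  have "cmod (\<Psi> \<omega>1) \<le> \<Psi>max"
    unfolding assms(10) using fin(2) \<omega>1(1) by (intro Max_ge) auto
  then have \<Psi>max: "0 < \<Psi>max" using \<omega>1(2) by (meson less_le_trans zero_less_norm_iff)

  let ?p = "step_distr L t \<omega>0" and ?q = "step_distr K t (fst \<omega>0)"
  define m where "m = ev ^ t * \<Psi> \<omega>0"
  define a where "a = cmod m"
  define v where "v = R / (2 * \<gamma>)"
  have "4 * R / (\<gamma> * \<epsilon>) \<le> ((1 - \<gamma>) ^ t * \<Psi>max)\<^sup>2"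
    using \<gamma> R \<Psi>max assms(11,12) by (intro mean_square_ge_of_time_bound) auto
  also have "\<dots> \<le> a\<^sup>2"
  proof (rule power_mono)
    have "1 - \<gamma> \<le> cmod ev" using complex_Re_le_cmod[of ev] \<gamma>(3) by linarith
    then show "(1 - \<gamma>) ^ t * \<Psi>max \<le> a"
      unfolding a_def m_def norm_mult norm_power \<omega>0(2)
      using \<gamma> \<Psi>max by (intro mult_right_mono power_mono) auto
  qed (use \<gamma> \<Psi>max in auto)
  finally have a2: "4 * R / (\<gamma> * \<epsilon>) \<le> a\<^sup>2" .
  then have "0 < a\<^sup>2" using R \<gamma>(1) assms(11) by (meson divide_pos_pos less_le_trans mult_pos_pos zero_less_numeral)
  then have "0 < a" by (simp add: a_def)
  have half: "4 * v / a\<^sup>2 \<le> \<epsilon> / 2"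
    using a2 \<gamma>(1) assms(11) \<open>0 < a\<^sup>2\<close> by (simp add: v_def field_simps)

  \<comment> \<open>The event that separates the two laws.\<close>
  let ?A = "{x \<in> fst ` \<Omega>. a / 2 \<le> g x}"

  have "measure_pmf.prob ?p {\<omega>. cmod (\<Psi> \<omega>) < cmod m / 2} \<le> 4 * v / (cmod m)\<^sup>2"
  proof (rule prob_cmod_less_half_mean)
    show "finite (set_pmf ?p)" using finite_set_step_distr[OF L \<omega>0(1)] .
    show "m = measure_pmf.expectation ?p \<Psi>"
      by (simp add: m_def expectation_eigenfunction_step_distr[OF L eig \<omega>0(1)])
    show "m \<noteq> 0" using \<open>0 < a\<close> by (auto simp: a_def)
    show "measure_pmf.expectation ?p (\<lambda>\<omega>. (cmod (\<Psi> \<omega>))\<^sup>2) \<le> (cmod m)\<^sup>2 + v"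
      using second_moment_le[OF L eig \<omega>0(1) _ _ incr, of t] \<gamma> by (simp add: m_def v_def)
  qed
  then have low: "measure_pmf.prob ?p {\<omega>. cmod (\<Psi> \<omega>) < a / 2} \<le> \<epsilon> / 2"
    using half by (simp add: a_def)
  have "measure_pmf.prob ?p (- (fst -` ?A)) \<le> measure_pmf.prob ?p {\<omega>. cmod (\<Psi> \<omega>) < a / 2}"
  proof (rule measure_pmf.finite_measure_mono_AE)
    show "AE \<omega> in ?p. \<omega> \<in> - (fst -` ?A) \<longrightarrow> \<omega> \<in> {\<omega>. cmod (\<Psi> \<omega>) < a / 2}"
      using set_step_distr[OF L \<omega>0(1), of t] g by (auto simp: AE_measure_pmf_iff)
  qed simp
  moreover have "measure_pmf.prob ?p (- (fst -` ?A)) = 1 - measure_pmf.prob ?p (fst -` ?A)"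
    using measure_pmf.prob_compl[of "fst -` ?A" ?p] by (simp add: Compl_eq_Diff_UNIV)
  moreover have "measure_pmf.prob ?q ?A = measure_pmf.prob ?p (fst -` ?A)"
    by (subst map_step_distr_lifting[OF lift \<omega>0(1), symmetric]) simp
  ultimately have q: "1 - \<epsilon> / 2 \<le> measure_pmf.prob ?q ?A" using low by linarith

  \<comment> \<open>The extension of \<open>|\<Psi>|\<^sup>2\<close> to the original chain; it is zero where there is no lift.\<close>
  define h where "h = (\<lambda>x. if x \<in> fst ` \<Omega> then (g x)\<^sup>2 else 0)"
  have "measure_pmf.expectation \<mu> h \<le> R / (1 - (1 - 2 * \<gamma>))"
  proof (rule stationary_drift_le)
    show "finite (set_pmf \<mu>)" using \<mu>(1) fin(1) finite_subset by blast
    show "finite (set_pmf (K x))" if "x \<in> set_pmf \<mu>" for x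
      using finite_set_kernel[OF K] that \<mu>(1) by blast
    show "h x = 0" if "x \<notin> fst ` \<Omega>" for x using that by (simp add: h_def)
  next
    fix x assume "x \<in> fst ` \<Omega>"
    \<comment> \<open>Any lift of \<open>x\<close> will do, because \<open>|\<Psi>|\<close> and the projected kernel depend on \<open>x\<close> alone.\<close>
    then obtain \<omega> where \<omega>: "\<omega> \<in> \<Omega>" "x = fst \<omega>" by blast
    have supp: "set_pmf (L \<omega>) \<subseteq> \<Omega>" using L \<omega>(1) by (auto simp: finite_markov_chain_def)
    have Kx: "K x = map_pmf fst (L \<omega>)" using proj \<omega> by simp
    show "set_pmf (K x) \<subseteq> fst ` \<Omega>" using supp by (auto simp: Kx)
    have h: "h (fst \<omega>') = (cmod (\<Psi> \<omega>'))\<^sup>2" if "\<omega>' \<in> \<Omega>" for \<omega>'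
      using that by (simp add: h_def g)
    have "measure_pmf.expectation (K x) h = measure_pmf.expectation (L \<omega>) (\<lambda>\<omega>'. (cmod (\<Psi> \<omega>'))\<^sup>2)"
      unfolding Kx integral_map_pmf using supp h by (intro expectation_cong) auto
    then show "measure_pmf.expectation (K x) h \<le> (1 - 2 * \<gamma>) * h x + R"
      using expectation_eigenfunction_square[OF L eig \<omega>(1)] incr[OF \<omega>(1)] h[OF \<omega>(1)] \<omega>(2) \<gamma>(3)
      by simp
  qed (use \<mu>(2) \<gamma> R in auto)
  then have Eh: "measure_pmf.expectation \<mu> h \<le> v" by (simp add: v_def)
  have "measure_pmf.prob \<mu> ?A \<le> measure_pmf.prob \<mu> {x. (a / 2)\<^sup>2 \<le> h x}"
  proof (rule measure_pmf.finite_measure_mono)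
    show "?A \<subseteq> {x. (a / 2)\<^sup>2 \<le> h x}"
      using \<open>0 < a\<close> by (auto simp: h_def intro!: power_mono)
  qed simp
  also have "\<dots> \<le> measure_pmf.expectation \<mu> h / (a / 2)\<^sup>2"
    using \<mu>(1) fin(1) finite_subset \<open>0 < a\<close>
    by (intro prob_ge_le_expectation_divide) (auto simp: h_def)
  also have "\<dots> \<le> v / (a / 2)\<^sup>2"
    using Eh by (rule divide_right_mono) simp
  also have "\<dots> = 4 * v / a\<^sup>2" by (simp add: power_divide)
  finally have "measure_pmf.prob \<mu> ?A \<le> \<epsilon> / 2" using half by linarith
  with q have "1 - \<epsilon> \<le> measure_pmf.prob ?q ?A - measure_pmf.prob \<mu> ?A" by linarith
  also have "\<dots> \<le> tv_dist S ?q \<mu>"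
    using fst\<Omega> by (intro tv_dist_ge[OF fin(1)]) auto
  also have "\<dots> \<le> Max ((\<lambda>x. tv_dist S (step_distr K t x) \<mu>) ` S)"
    using fin(1) fst\<Omega> \<omega>0(1) by (intro Max_ge) auto
  finally show ?thesis .
qed

end
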